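(* For $n\ge k^2$, any zero-error protocol using public randomness for the online set-intersection problem must have expected total communication cost at least $\Omega(k\log\log k)$.
   Context: Online communication model: Alice receives her whole input $X$ at the start; Bob receives inputs $Y_1,\dots,Y_k$ one at a time. The game has $k$ stages; in stage $i$, $Y_i$ is revealed to Bob, the players communicate (remembering all previous transcripts), and Bob must output $f_i(X,Y_i)$; at the end of stage $i$, $Y_i$ is revealed to Alice. Cost is the total number of bits communicated over all stages. Online set-intersection: Alice is given $X\subseteq[n]$ with $|X|=k$; in stage $i$ Bob is given $Y_i\in[n]$, and $f_i(X,Y_i)$ is whether $Y_i\in X$. *)

theory Defs
  imports "HOL-Probability.Probability"
begin

text \<open>
  The communication of one stage is an ordinary two-party protocol tree.  Every inner node costs
  one bit; the bit sent depends on the node and on the private input of the speaker.  At a leaf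
  Bob alone produces the output, so it may depend on his input.
\<close>

datatype ('a, 'b, 'o) protocol_tree =
    Output "'b \<Rightarrow> 'o"
  | Alice_Sends "'a \<Rightarrow> bool" "bool \<Rightarrow> ('a, 'b, 'o) protocol_tree"
  | Bob_Sends "'b \<Rightarrow> bool" "bool \<Rightarrow> ('a, 'b, 'o) protocol_tree"

primrec transcript :: "('a, 'b, 'o) protocol_tree \<Rightarrow> 'a \<Rightarrow> 'b \<Rightarrow> bool list" where
  "transcript (Output g) x y = []"
| "transcript (Alice_Sends s t) x y = s x # transcript (t (s x)) x y"
| "transcript (Bob_Sends s t) x y = s y # transcript (t (s y)) x y"

primrec result :: "('a, 'b, 'o) protocol_tree \<Rightarrow> 'a \<Rightarrow> 'b \<Rightarrow> 'o" where
  "result (Output g) x y = g y"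
| "result (Alice_Sends s t) x y = result (t (s x)) x y"
| "result (Bob_Sends s t) x y = result (t (s y)) x y"

text \<open>
  What both players know at the start of a stage is the list, in chronological order, of Bob's
  earlier inputs (revealed to Alice at the end of their stages) together with the transcripts of
  the earlier stages.  A deterministic online protocol chooses the tree of the next stage from
  this common knowledge; all bits sent in that stage may therefore depend on it.  Bob's current
  input enters only at the nodes \<^const>\<open>Bob_Sends\<close> and \<^const>\<open>Output\<close>.
\<close>

type_synonym 'b history = "('b \<times> bool list) list"

type_synonym ('a, 'b, 'o) online_protocol = "'b history \<Rightarrow> ('a, 'b, 'o) protocol_tree"

primrec run_from ::
  "('a, 'b, 'o) online_protocol \<Rightarrow> 'a \<Rightarrow> 'b history \<Rightarrow> 'b list \<Rightarrow> 'b history" where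
  "run_from P x h [] = h"
| "run_from P x h (y # ys) = run_from P x (h @ [(y, transcript (P h) x y)]) ys"

definition run :: "('a, 'b, 'o) online_protocol \<Rightarrow> 'a \<Rightarrow> 'b list \<Rightarrow> 'b history" where
  "run P x ys = run_from P x [] ys"

definition total_cost :: "('a, 'b, 'o) online_protocol \<Rightarrow> 'a \<Rightarrow> 'b list \<Rightarrow> nat" where
  "total_cost P x ys = (\<Sum>(y, w)\<leftarrow>run P x ys. length w)"

text \<open>Stages are numbered from 0, so stage \<open>i\<close> has Bob's input \<open>ys ! i\<close>.\<close>

definition stage_output :: "('a, 'b, 'o) online_protocol \<Rightarrow> 'a \<Rightarrow> 'b list \<Rightarrow> nat \<Rightarrow> 'o" where
  "stage_output P x ys i = result (P (run P x (take i ys))) x (ys ! i)"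

definition correct_on ::
  "(nat \<Rightarrow> 'a \<Rightarrow> 'b \<Rightarrow> 'o) \<Rightarrow> ('a, 'b, 'o) online_protocol \<Rightarrow> 'a \<Rightarrow> 'b list \<Rightarrow> bool" where
  "correct_on f P x ys \<longleftrightarrow> (\<forall>i<length ys. stage_output P x ys i = f i x (ys ! i))"

text \<open>
  A protocol with public randomness is a probability distribution on deterministic protocols.
  The underlying sigma-algebra is arbitrary, subject to the cost on each admissible input being a
  random variable.  Zero error means that on each admissible input all \<open>k\<close> outputs are correct
  with probability 1.
\<close>

definition zero_error_protocol ::
  "(nat \<Rightarrow> 'a \<Rightarrow> 'b \<Rightarrow> 'o) \<Rightarrow> ('a \<times> 'b list) set \<Rightarrow> ('a, 'b, 'o) online_protocol measure \<Rightarrow> bool"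
where
  "zero_error_protocol f D M \<longleftrightarrow>
     prob_space M \<and>
     (\<forall>(x, ys)\<in>D. (\<lambda>P. total_cost P x ys) \<in> measurable M (count_space UNIV)) \<and>
     (\<forall>(x, ys)\<in>D. AE P in M. correct_on f P x ys)"

text \<open>The expectation is over the public randomness only, for a worst-case input.\<close>

definition expected_cost ::
  "('a \<times> 'b list) set \<Rightarrow> ('a, 'b, 'o) online_protocol measure \<Rightarrow> ennreal" where
  "expected_cost D M = (SUP (x, ys)\<in>D. \<integral>\<^sup>+ P. of_nat (total_cost P x ys) \<partial>M)"

definition set_intersection_inputs :: "nat \<Rightarrow> nat \<Rightarrow> (nat set \<times> nat list) set" where
  "set_intersection_inputs n k =
     {(X, Ys). X \<subseteq> {1..n} \<and> card X = k \<and> set Ys \<subseteq> {1..n} \<and> length Ys = k}"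

definition set_intersection :: "nat \<Rightarrow> nat set \<Rightarrow> nat \<Rightarrow> bool" where
  "set_intersection i X y \<longleftrightarrow> y \<in> X"

end

theory Submission
  imports Defs "HOL-Combinatorics.Multiset_Permutations"
begin

text \<open>
  Fix a deterministic correct protocol, let \<open>X\<close> be a uniformly random \<open>k\<close>-subset of \<open>{1..n}\<close> and let
  Bob's inputs be the elements of \<open>X\<close> in uniformly random order.  A leaf of a stage with answer "yes"
  carries a rectangle \<open>A \<times> B\<close> with \<open>B \<subseteq> X\<close> for all \<open>X \<in> A\<close>.  If \<open>B\<close> has at most \<open>m\<close> elements that are
  not yet revealed, then the transcript of this stage pins down Bob's input up to \<open>m\<close> choices, which
  costs about \<open>log (k / m)\<close> bits.  Otherwise Alice's bits so far have isolated a family \<open>A\<close> whose members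
  share more than \<open>m\<close> unrevealed elements; since \<open>n \<ge> k\<^sup>2\<close>, only a fraction \<open>k^(-m)\<close> of the sets still
  possible do so.  Both effects are recorded in one bound on the sum of \<open>2^(-cost)\<close> over the inputs;
  with \<open>m\<close> about \<open>k / sqrt (log k)\<close> the bound forces, by convexity, an average cost of at least
  \<open>k log log k / 4\<close>.  Averaging over the public randomness concludes.
\<close>

section \<open>Weight of a single stage\<close>

lemma half_le: "a \<le> x \<Longrightarrow> b \<le> y \<Longrightarrow> a / 2 + b / 2 \<le> (x + y) / 2" for a b x y :: real
  by simp

text \<open>\<open>W X y w\<close> is the total weight of the later stages after the current one used \<open>y\<close> and \<open>w\<close>.\<close>

lemma protocol_tree_weight_le:
  fixes T :: "('b set, 'b, bool) protocol_tree" and W :: "'b set \<Rightarrow> 'b \<Rightarrow> bool list \<Rightarrow> real"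
  assumes nonneg: "0 \<le> m" "0 \<le> v" "0 \<le> e" "0 \<le> k" "0 \<le> u"
    and fin: "finite A" "finite B"
    and correct: "\<And>X y. X \<in> A \<Longrightarrow> y \<in> B \<Longrightarrow> result T X y \<longleftrightarrow> y \<in> X"
    and W: "\<And>y w. y \<in> B \<Longrightarrow> (\<Sum>X\<in>{X\<in>A. y \<in> X \<and> transcript T X y = w}. W X y w)
              \<le> v * real (card {X\<in>A. y \<in> X \<and> transcript T X y = w}) + u"
    and rect: "\<And>A' B'. A' \<subseteq> A \<Longrightarrow> B' \<subseteq> B \<Longrightarrow> A' \<noteq> {} \<Longrightarrow> (\<And>X. X \<in> A' \<Longrightarrow> B' \<subseteq> X) \<Longrightarrow>
              real (card B') * real (card A') \<le> m * real (card A') + e \<and> real (card B') \<le> k"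
  shows "(\<Sum>X\<in>A. \<Sum>y\<in>B \<inter> X. W X y (transcript T X y) / 2 ^ length (transcript T X y))
           \<le> m * v * real (card A) + v * e + k * u"
  using fin correct W rect
\<comment> \<open>Every inner node costs one bit and so halves the weights below it: the bound at a
  node comes from averaging the bounds at its two children. A child sees a smaller \<open>A\<close>
  or \<open>B\<close>, and \<open>W\<close> with the bit just sent prefixed to the
  transcript.\<close>
proof (induction T arbitrary: A B W)
  case (Output g)
  show ?case
  proof (cases "A = {}")
    case True
    then show ?thesis using nonneg by simp
  next
    case False
    \<comment> \<open>Bob's output at a leaf depends on \<open>y\<close> alone, so by correctness
      all members of \<open>A\<close> meet \<open>B\<close> in the same set \<open>B'\<close>, and
      \<open>rect\<close> applies to \<open>A\<close> and \<open>B'\<close>.\<close>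
    define B' where "B' = {y\<in>B. g y}"
    have eq: "B \<inter> X = B'" if "X \<in> A" for X
      using Output.prems(3) that by (auto simp: B'_def)
    have r: "real (card B') * real (card A) \<le> m * real (card A) + e" "real (card B') \<le> k"
      using Output.prems(5)[of A B'] False eq by (auto simp: B'_def)
    have W': "(\<Sum>X\<in>A. W X y []) \<le> v * real (card A) + u" if "y \<in> B'" for y
    proof -
      have "{X \<in> A. y \<in> X} = A" using eq that by auto
      then show ?thesis using Output.prems(4)[of y "[]"] that by (simp add: B'_def)
    qed
    have "(\<Sum>X\<in>A. \<Sum>y\<in>B \<inter> X. W X y []) = (\<Sum>y\<in>B'. \<Sum>X\<in>A. W X y [])"
      by (subst sum.swap) (simp add: eq)
    also have "\<dots> \<le> (\<Sum>y\<in>B'. v * real (card A) + u)"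
      by (intro sum_mono W')
    also have "\<dots> = v * (real (card B') * real (card A)) + real (card B') * u"
      by (simp add: algebra_simps)
    also have "\<dots> \<le> v * (m * real (card A) + e) + k * u"
      using r nonneg by (intro add_mono mult_left_mono mult_right_mono) auto
    finally show ?thesis by (simp add: algebra_simps)
  qed
next
  case (Alice_Sends s t)
  \<comment> \<open>Alice's bit splits \<open>A\<close>. The main term is additive in
    \<open>card A\<close>, while \<open>v * e + k * u\<close> appears once per child and is
    preserved by averaging.\<close>
  define S where "S b = {X\<in>A. s X = b}" for b
  have IH: "(\<Sum>X\<in>S b. \<Sum>y\<in>B \<inter> X. W X y (b # transcript (t b) X y) / 2 ^ length (transcript (t b) X y))
      \<le> m * v * real (card (S b)) + v * e + k * u" for b
  proof (rule Alice_Sends.IH)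
    show "result (t b) X y \<longleftrightarrow> y \<in> X" if "X \<in> S b" "y \<in> B" for X y
      using Alice_Sends.prems(3)[of X y] that by (auto simp: S_def)
    show "(\<Sum>X\<in>{X\<in>S b. y \<in> X \<and> transcript (t b) X y = w}. W X y (b # w))
        \<le> v * real (card {X\<in>S b. y \<in> X \<and> transcript (t b) X y = w}) + u" if "y \<in> B" for y w
    proof -
      have "{X\<in>S b. y \<in> X \<and> transcript (t b) X y = w} =
            {X\<in>A. y \<in> X \<and> transcript (Alice_Sends s t) X y = b # w}"
        by (auto simp: S_def)
      then show ?thesis using Alice_Sends.prems(4)[OF that, of "b # w"] by simp
    qed
    show "real (card B') * real (card A') \<le> m * real (card A') + e \<and> real (card B') \<le> k"
      if "A' \<subseteq> S b" "B' \<subseteq> B" "A' \<noteq> {}" "\<And>X. X \<in> A' \<Longrightarrow> B' \<subseteq> X" for A' B'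
      using that by (intro Alice_Sends.prems(5)) (auto simp: S_def)
  qed (use Alice_Sends.prems(1,2) in \<open>auto simp: S_def\<close>)
  have split: "A = S True \<union> S False" "S True \<inter> S False = {}" "finite (S True)" "finite (S False)"
    using Alice_Sends.prems(1) by (auto simp: S_def)
  let ?f = "\<lambda>X. \<Sum>y\<in>B \<inter> X. W X y (transcript (Alice_Sends s t) X y)
              / 2 ^ length (transcript (Alice_Sends s t) X y)"
  have half: "sum ?f (S b) = (\<Sum>X\<in>S b. \<Sum>y\<in>B \<inter> X.
      W X y (b # transcript (t b) X y) / 2 ^ length (transcript (t b) X y)) / 2" for b
    unfolding sum_divide_distrib by (intro sum.cong) (auto simp: S_def)
  have "sum ?f A = sum ?f (S True \<union> S False)"
    using split(1) by (rule arg_cong)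
  also have "\<dots> = sum ?f (S True) + sum ?f (S False)"
    using split by (intro sum.union_disjoint)
  also have "\<dots> \<le> (m * v * real (card (S True)) + v * e + k * u
                   + (m * v * real (card (S False)) + v * e + k * u)) / 2"
    unfolding half by (rule half_le[OF IH IH])
  also have "\<dots> = m * v * (real (card (S True)) + real (card (S False))) / 2 + v * e + k * u"
    by (simp add: field_simps)
  also have "real (card (S True)) + real (card (S False)) = real (card A)"
    unfolding split(1) using split by (simp add: card_Un_disjoint)
  \<comment> \<open>The halving of the main term is given up here, so that one bound serves both
    kinds of node.\<close>
  also have "m * v * real (card A) / 2 + v * e + k * u \<le> m * v * real (card A) + v * e + k * u"
    using nonneg by simp
  finally show ?case .
next
  case (Bob_Sends s t)
  \<comment> \<open>Bob's bit splits \<open>B\<close> and leaves \<open>A\<close> whole, so both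
    children have the same bound and averaging returns it.\<close>
  define S where "S b = {y\<in>B. s y = b}" for b
  have IH: "(\<Sum>X\<in>A. \<Sum>y\<in>S b \<inter> X. W X y (b # transcript (t b) X y) / 2 ^ length (transcript (t b) X y))
      \<le> m * v * real (card A) + v * e + k * u" for b
  proof (rule Bob_Sends.IH)
    show "result (t b) X y \<longleftrightarrow> y \<in> X" if "X \<in> A" "y \<in> S b" for X y
      using Bob_Sends.prems(3)[of X y] that by (auto simp: S_def)
    show "(\<Sum>X\<in>{X\<in>A. y \<in> X \<and> transcript (t b) X y = w}. W X y (b # w))
        \<le> v * real (card {X\<in>A. y \<in> X \<and> transcript (t b) X y = w}) + u" if "y \<in> S b" for y w
    proof -
      have "y \<in> B" "s y = b" using that by (auto simp: S_def)
      then show ?thesis using Bob_Sends.prems(4)[of y "b # w"] by simp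
    qed
    show "real (card B') * real (card A') \<le> m * real (card A') + e \<and> real (card B') \<le> k"
      if "A' \<subseteq> A" "B' \<subseteq> S b" "A' \<noteq> {}" "\<And>X. X \<in> A' \<Longrightarrow> B' \<subseteq> X" for A' B'
      using that by (intro Bob_Sends.prems(5)) (auto simp: S_def)
  qed (use Bob_Sends.prems(1,2) in \<open>auto simp: S_def\<close>)
  let ?f = "\<lambda>X y. W X y (transcript (Bob_Sends s t) X y)
              / 2 ^ length (transcript (Bob_Sends s t) X y)"
  have half: "(\<Sum>X\<in>A. \<Sum>y\<in>S b \<inter> X. ?f X y) = (\<Sum>X\<in>A. \<Sum>y\<in>S b \<inter> X.
      W X y (b # transcript (t b) X y) / 2 ^ length (transcript (t b) X y)) / 2" for b
    unfolding sum_divide_distrib by (intro sum.cong) (auto simp: S_def)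
  have "(\<Sum>y\<in>B \<inter> X. ?f X y) = (\<Sum>y\<in>S True \<inter> X. ?f X y) + (\<Sum>y\<in>S False \<inter> X. ?f X y)" for X
  proof -
    have "B \<inter> X = (S True \<inter> X) \<union> (S False \<inter> X)" by (auto simp: S_def)
    then have "(\<Sum>y\<in>B \<inter> X. ?f X y) = (\<Sum>y\<in>(S True \<inter> X) \<union> (S False \<inter> X). ?f X y)"
      by (rule arg_cong)
    also have "\<dots> = (\<Sum>y\<in>S True \<inter> X. ?f X y) + (\<Sum>y\<in>S False \<inter> X. ?f X y)"
      using Bob_Sends.prems(2) by (intro sum.union_disjoint) (auto simp: S_def)
    finally show ?thesis .
  qed
  then have "(\<Sum>X\<in>A. \<Sum>y\<in>B \<inter> X. ?f X y) =
      (\<Sum>X\<in>A. \<Sum>y\<in>S True \<inter> X. ?f X y) + (\<Sum>X\<in>A. \<Sum>y\<in>S False \<inter> X. ?f X y)"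
    by (simp only: sum.distrib)
  also have "\<dots> \<le> (m * v * real (card A) + v * e + k * u + (m * v * real (card A) + v * e + k * u)) / 2"
    unfolding half by (rule half_le[OF IH IH])
  also have "\<dots> = m * v * real (card A) + v * e + k * u" by simp
  finally show ?case .
qed

section \<open>Remaining cost and counting of supersets\<close>

text \<open>Adds up the cost from the front, so that an induction can peel off the current stage;
  \<open>total_cost\<close> reads it off the final history instead.\<close>

primrec remaining_cost ::
  "('a, 'b, 'o) online_protocol \<Rightarrow> 'a \<Rightarrow> 'b history \<Rightarrow> 'b list \<Rightarrow> nat" where
  "remaining_cost P x h [] = 0"
| "remaining_cost P x h (y # ys) =
     length (transcript (P h) x y) + remaining_cost P x (h @ [(y, transcript (P h) x y)]) ys"

lemma total_cost_eq_remaining_cost: "total_cost P x ys = remaining_cost P x [] ys"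
proof -
  have "(\<Sum>(y, w)\<leftarrow>run_from P x h ys. length w) =
        (\<Sum>(y, w)\<leftarrow>h. length w) + remaining_cost P x h ys" for h
    by (induction ys arbitrary: h) auto
  then show ?thesis by (simp add: total_cost_def run_def)
qed

text \<open>Forcing one element into a \<open>K\<close>-subset of an \<open>N\<close>-set keeps a
  fraction \<open>K / N\<close> of the subsets. This is at most \<open>1 / k\<close> at each of the
  \<open>card S\<close> steps.\<close>

lemma card_supersets_le:
  fixes k :: nat
  assumes "finite U" "k ^ 2 \<le> card U" "S \<subseteq> U" "card S \<le> k"
  shows "card {X. X \<subseteq> U \<and> card X = k \<and> S \<subseteq> X} * k ^ card S \<le> card U choose k"
proof -
  have fS: "finite S" using assms finite_subset by blast
  have "bij_betw (\<lambda>X. X \<union> S) {Z. Z \<subseteq> U - S \<and> card Z = k - card S}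
          {X. X \<subseteq> U \<and> card X = k \<and> S \<subseteq> X}"
  proof (rule bij_betwI[where g = "\<lambda>X. X - S"])
    show "(\<lambda>X. X \<union> S) \<in> {Z. Z \<subseteq> U - S \<and> card Z = k - card S}
            \<rightarrow> {X. X \<subseteq> U \<and> card X = k \<and> S \<subseteq> X}"
    proof
      fix Z assume "Z \<in> {Z. Z \<subseteq> U - S \<and> card Z = k - card S}"
      then have Z: "Z \<subseteq> U - S" "card Z = k - card S" by auto
      then have "finite Z" using assms(1) finite_subset by blast
      then have "card (Z \<union> S) = k"
        using Z fS assms(4) by (subst card_Un_disjoint) auto
      then show "Z \<union> S \<in> {X. X \<subseteq> U \<and> card X = k \<and> S \<subseteq> X}" using Z assms(3) by auto
    qed
    show "(\<lambda>X. X - S) \<in> {X. X \<subseteq> U \<and> card X = k \<and> S \<subseteq> X}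
            \<rightarrow> {Z. Z \<subseteq> U - S \<and> card Z = k - card S}"
      using fS by (auto simp: card_Diff_subset)
  qed auto
  then have card: "card {X. X \<subseteq> U \<and> card X = k \<and> S \<subseteq> X} = (card U - card S) choose (k - card S)"
    using n_subsets[of "U - S" "k - card S"] assms(1,3) fS
    by (simp add: bij_betw_same_card[symmetric] card_Diff_subset)
  have "s \<le> k \<Longrightarrow> ((card U - s) choose (k - s)) * k ^ s \<le> card U choose k" for s
  proof (induction s)
    case (Suc s)
    define N' K' where "N' = card U - s" and "K' = k - s"
    \<comment> \<open>The point where \<open>k ^ 2 \<le> card U\<close> enters: with
      \<open>s\<close> elements already fixed, the ratio \<open>K' / N'\<close> is still at most
      \<open>1 / k\<close>.\<close>
    have "k * K' \<le> N'"
    proof -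
      have "k * K' + s \<le> k * K' + k * s" using Suc.prems by simp
      also have "\<dots> = k ^ 2"
        using Suc.prems by (simp add: K'_def power2_eq_square flip: distrib_left)
      finally show ?thesis using assms(2) by (simp add: N'_def)
    qed
    moreover have "0 < K'" using Suc.prems by (simp add: K'_def)
    ultimately have "K' * (k * ((N' - 1) choose (K' - 1))) \<le> N' * ((N' - 1) choose (K' - 1))"
      by (metis mult.assoc mult.commute mult_le_mono1)
    also have "\<dots> = K' * (N' choose K')"
      using times_binomial_minus1_eq[OF \<open>0 < K'\<close>] by simp
    finally have "k * ((N' - 1) choose (K' - 1)) \<le> N' choose K'"
      using \<open>0 < K'\<close> by simp
    then have "((card U - Suc s) choose (k - Suc s)) * k ^ Suc s \<le> (N' choose K') * k ^ s"
      by (simp add: N'_def K'_def mult.assoc[symmetric] mult.commute)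
    also have "\<dots> \<le> card U choose k"
      using Suc by (simp add: N'_def K'_def)
    finally show ?case .
  qed simp
  then show ?thesis using card assms(4) by simp
qed

section \<open>Weight of all remaining stages\<close>

lemma sum_permutations_of_set_Cons:
  assumes "finite A" "A \<noteq> {}"
  shows "(\<Sum>xs\<in>permutations_of_set A. f xs) =
         (\<Sum>x\<in>A. \<Sum>xs\<in>permutations_of_set (A - {x}). f (x # xs))"
proof -
  have "(\<Sum>xs\<in>permutations_of_set A. f xs) =
        (\<Sum>x\<in>A. \<Sum>xs\<in>(#) x ` permutations_of_set (A - {x}). f xs)"
    unfolding permutations_of_set_nonempty[OF assms(2)]
    using assms(1) by (intro sum.UNION_disjoint) auto
  then show ?thesis by (simp add: sum.reindex)
qed

text \<open>Induction on the number \<open>r\<close> of stages left; \<open>R\<close> holds the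
  inputs revealed so far and \<open>A\<close> the sets not yet ruled out. The factor
  \<open>real m ^ r\<close> stands for \<open>m\<close> choices of Bob's input per stage. The second
  term collects the exceptional families sharing more than \<open>m\<close> unrevealed elements; it
  is measured against all \<open>k\<close>-subsets of \<open>U\<close>, not against
  \<open>A\<close>.\<close>

lemma online_protocol_weight_le:
  fixes P :: "('b set, 'b, bool) online_protocol" and k m r :: nat
  assumes U: "finite U" "k ^ 2 \<le> card U" and k: "2 \<le> k" "m \<le> k"
    and A: "A \<subseteq> {X. X \<subseteq> U \<and> card X = k}"
    and R: "\<And>X. X \<in> A \<Longrightarrow> R \<subseteq> X" "R \<subseteq> U" "card R + r = k"
    and correct: "\<And>X ys i. X \<in> A \<Longrightarrow> set ys \<subseteq> U \<Longrightarrow> length ys = r \<Longrightarrow> i < r \<Longrightarrow>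
      result (P (run_from P X h (take i ys))) X (ys ! i) \<longleftrightarrow> ys ! i \<in> X"
  shows "(\<Sum>X\<in>A. \<Sum>ys\<in>permutations_of_set (X - R). 1 / 2 ^ remaining_cost P X h ys)
      \<le> real m ^ r * real (card A) + real (card U choose k) * real k ^ (2 * r + 1) / real k ^ (k + m)"
  using A R correct
proof (induction r arbitrary: A R h)
  case 0
  have "(\<Sum>ys\<in>permutations_of_set (X - R). 1 / 2 ^ remaining_cost P X h ys :: real) = 1"
    if "X \<in> A" for X
  proof -
    have "finite X" "card X = k" using 0(1) that finite_subset[OF _ U(1)] by auto
    then have "X = R" using 0(2)[OF that] 0(4) card_subset_eq[of X R] by auto
    then show ?thesis by simp
  qed
  then show ?case by simp
next
  case (Suc r)
  define N where "N = real (card U choose k)"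
  define u where "u = N * real k ^ (2 * r + 1) / real k ^ (k + m)"
  define e where "e = real k * (N / real k ^ (card R + m))"
  define W :: "'b set \<Rightarrow> 'b \<Rightarrow> bool list \<Rightarrow> real" where
    "W X y w = (\<Sum>ys\<in>permutations_of_set (X - R - {y}). 1 / 2 ^ remaining_cost P X (h @ [(y, w)]) ys)"
    for X y w
  have finX: "finite X" "card X = k" "X \<subseteq> U" "R \<subseteq> X" if "X \<in> A" for X
    using Suc.prems(1,2) that finite_subset[OF _ U(1)] by auto
  have finA: "finite A"
    using Suc.prems(1) U(1) by (auto intro: finite_subset[of _ "Pow U"])
  have finR: "finite R" using Suc.prems(3) U(1) finite_subset by blast
  have "(\<Sum>X\<in>A. \<Sum>ys\<in>permutations_of_set (X - R). 1 / 2 ^ remaining_cost P X h ys) =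
     (\<Sum>X\<in>A. \<Sum>y\<in>(U - R) \<inter> X. W X y (transcript (P h) X y) / 2 ^ length (transcript (P h) X y))"
  proof (intro sum.cong refl)
    fix X assume X: "X \<in> A"
    have "(U - R) \<inter> X = X - R" using finX[OF X] by auto
    moreover have "X - R \<noteq> {}"
    proof -
      have "X \<noteq> R" using finX(2)[OF X] Suc.prems(4) by auto
      then show ?thesis using finX(4)[OF X] by auto
    qed
    ultimately show "(\<Sum>ys\<in>permutations_of_set (X - R). 1 / 2 ^ remaining_cost P X h ys) =
     (\<Sum>y\<in>(U - R) \<inter> X. W X y (transcript (P h) X y) / 2 ^ length (transcript (P h) X y))"
      using finX[OF X]
      by (simp add: sum_permutations_of_set_Cons W_def sum_divide_distrib power_add mult.commute)
  qed
  also have "\<dots> \<le> real m * real m ^ r * real (card A) + real m ^ r * e + real k * u"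
  proof (rule protocol_tree_weight_le)
    show "0 \<le> e" "0 \<le> u" by (auto simp: e_def u_def N_def)
    \<comment> \<open>Correctness is assumed for whole input lists, so \<open>y\<close> is padded
      with copies of itself and only stage 0 is read off.\<close>
    show "result (P h) X y \<longleftrightarrow> y \<in> X" if "X \<in> A" "y \<in> U - R" for X y
      using Suc.prems(5)[of X "y # replicate r y" 0] that
      by (auto simp: set_replicate_conv_if)
    show "(\<Sum>X\<in>{X\<in>A. y \<in> X \<and> transcript (P h) X y = w}. W X y w)
        \<le> real m ^ r * real (card {X\<in>A. y \<in> X \<and> transcript (P h) X y = w}) + u"
      if y: "y \<in> U - R" for y w
    proof -
      \<comment> \<open>The sets consistent with the extended history; the induction hypothesis
        applies to them with \<open>insert y R\<close> revealed.\<close>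
      define A' where "A' = {X\<in>A. y \<in> X \<and> transcript (P h) X y = w}"
      have "(\<Sum>X\<in>A'. \<Sum>ys\<in>permutations_of_set (X - insert y R).
              1 / 2 ^ remaining_cost P X (h @ [(y, w)]) ys) \<le> real m ^ r * real (card A') + u"
        unfolding u_def N_def
      proof (rule Suc.IH)
        show "result (P (run_from P X (h @ [(y, w)]) (take i ys))) X (ys ! i) \<longleftrightarrow> ys ! i \<in> X"
          if "X \<in> A'" "set ys \<subseteq> U" "length ys = r" "i < r" for X ys i
          using Suc.prems(5)[of X "y # ys" "Suc i"] that y by (auto simp: A'_def)
      qed (use Suc.prems y finR in \<open>auto simp: A'_def\<close>)
      moreover have "X - R - {y} = X - insert y R" for X by auto
      ultimately show ?thesis by (simp add: W_def A'_def)
    qed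
    show "real (card B') * real (card A') \<le> real m * real (card A') + e \<and> real (card B') \<le> real k"
      if AB: "A' \<subseteq> A" "B' \<subseteq> U - R" "A' \<noteq> {}" "\<And>X. X \<in> A' \<Longrightarrow> B' \<subseteq> X" for A' B'
    proof -
      obtain X where X: "X \<in> A'" using AB by auto
      then have XA: "X \<in> A" using AB by auto
      have finB: "finite B'" using AB(2) U(1) by (meson finite_Diff finite_subset)
      have cB: "card B' \<le> k"
        using AB(4)[OF X] finX[OF XA] card_mono by metis
      have cRB: "card (R \<union> B') = card R + card B'"
        using finR finB AB(2) by (subst card_Un_disjoint) auto
      have cRBk: "card (R \<union> B') \<le> k"
        using AB(4)[OF X] finX[OF XA] card_mono by (metis Un_least)
      have "real (card B') * real (card A') \<le> real m * real (card A') + e"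
      proof (cases "card B' \<le> m")
        case True
        then have "real (card B') * real (card A') \<le> real m * real (card A')"
          by (intro mult_right_mono) auto
        then show ?thesis by (simp add: e_def N_def add_increasing2)
      next
        case False
        \<comment> \<open>All members of \<open>A'\<close> contain \<open>R \<union> B'\<close>,
          which has more than \<open>card R + m\<close> elements, so \<open>A'\<close> is small
          enough for the term \<open>e\<close> to cover it.\<close>
        have "card A' \<le> card {X. X \<subseteq> U \<and> card X = k \<and> R \<union> B' \<subseteq> X}"
        proof (rule card_mono)
          show "finite {X. X \<subseteq> U \<and> card X = k \<and> R \<union> B' \<subseteq> X}" using U(1) by simp
          show "A' \<subseteq> {X. X \<subseteq> U \<and> card X = k \<and> R \<union> B' \<subseteq> X}"
            using AB(1) AB(4) finX(2-4) by blast
        qed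
        then have "card A' * k ^ card (R \<union> B') \<le> card U choose k"
          using card_supersets_le[OF U, of "R \<union> B'"] cRBk AB(2) Suc.prems(3)
          by (meson Diff_subset Un_least dual_order.trans mult_le_mono1)
        moreover have "card A' * k ^ (card R + m) \<le> card A' * k ^ card (R \<union> B')"
          using False k cRB by (intro mult_left_mono power_increasing) auto
        ultimately have "card A' * k ^ (card R + m) \<le> card U choose k" by linarith
        then have "real (card A') * real k ^ (card R + m) \<le> N"
          unfolding N_def by (metis of_nat_le_iff of_nat_mult of_nat_power)
        then have "real (card A') \<le> N / real k ^ (card R + m)"
          using k by (simp add: field_simps)
        then have "real (card B') * real (card A') \<le> e"
          unfolding e_def using cB by (intro mult_mono) auto
        then show ?thesis by (simp add: add_increasing)
      qed
      then show ?thesis using cB by simp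
    qed
  qed (use finA U in auto)
  finally have "(\<Sum>X\<in>A. \<Sum>ys\<in>permutations_of_set (X - R). 1 / 2 ^ remaining_cost P X h ys)
      \<le> real m ^ Suc r * real (card A) + (real m ^ r * e + real k * u)"
    by simp
  also have "real m ^ r * e + real k * u \<le> N * real k ^ (2 * Suc r + 1) / real k ^ (k + m)"
  proof -
    have e: "e = N * real k ^ (r + 2) / real k ^ (k + m)"
    proof -
      have "k + m = (card R + m) + Suc r" using Suc.prems(4) by simp
      then have "real k ^ (k + m) = real k ^ (card R + m) * real k ^ Suc r"
        by (metis power_add)
      then show ?thesis using k by (simp add: e_def field_simps)
    qed
    \<comment> \<open>The crude \<open>m \<le> k\<close> brings both errors to the same power of
      \<open>k\<close>; their sum costs a factor 2, absorbed by one more \<open>k\<close>. Hence the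
      growth by \<open>k ^ 2\<close> per stage.\<close>
    have "real m ^ r * e \<le> real k ^ r * e"
      using k by (intro mult_right_mono power_mono) (auto simp: e_def N_def)
    also have "\<dots> = N * real k ^ (2 * r + 2) / real k ^ (k + m)"
      by (simp add: e power_add mult_2)
    finally have "real m ^ r * e \<le> N * real k ^ (2 * r + 2) / real k ^ (k + m)" .
    moreover have "real k * u = N * real k ^ (2 * r + 2) / real k ^ (k + m)" by (simp add: u_def)
    ultimately have "real m ^ r * e + real k * u \<le> 2 * (N * real k ^ (2 * r + 2) / real k ^ (k + m))"
      by linarith
    also have "\<dots> \<le> real k * (N * real k ^ (2 * r + 2) / real k ^ (k + m))"
      using k by (intro mult_right_mono) (auto simp: N_def)
    finally show ?thesis by (simp add: mult_ac)
  qed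
  finally show ?case by (simp add: N_def)
qed

section \<open>Convexity and the choice of the threshold\<close>

text \<open>Jensen's inequality for the convex map sending \<open>x\<close> to
  \<open>2 powr - x\<close>; it turns a bound on weights into one on the average cost.\<close>

lemma sum_ge_of_sum_half_power_le:
  fixes c :: "'a \<Rightarrow> nat" and L :: real
  assumes "(\<Sum>a\<in>A. 1 / 2 ^ c a) \<le> real (card A) * 2 powr - L"
  shows "real (card A) * L \<le> (\<Sum>a\<in>A. real (c a))"
proof -
  \<comment> \<open>\<open>2 powr - x\<close> lies above its tangent at \<open>L\<close>.\<close>
  have tangent: "2 powr - L * (1 - ln 2 * (real (c a) - L)) \<le> 1 / 2 ^ c a" for a
  proof -
    have "1 - ln 2 * (real (c a) - L) \<le> exp (- (ln 2 * (real (c a) - L)))"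
      using exp_ge_add_one_self[of "- (ln 2 * (real (c a) - L))"] by simp
    also have "\<dots> = 2 powr (L - real (c a))" by (simp add: powr_def algebra_simps)
    finally have "2 powr - L * (1 - ln 2 * (real (c a) - L)) \<le> 2 powr - L * 2 powr (L - real (c a))"
      by (intro mult_left_mono) auto
    also have "\<dots> = 2 powr - real (c a)" by (simp flip: powr_add)
    also have "\<dots> = 1 / 2 ^ c a" by (simp add: powr_minus_divide powr_realpow)
    finally show ?thesis .
  qed
  have "2 powr - L * (\<Sum>a\<in>A. 1 - ln 2 * (real (c a) - L)) \<le> (\<Sum>a\<in>A. 1 / 2 ^ c a)"
    unfolding sum_distrib_left by (intro sum_mono tangent)
  also have "\<dots> \<le> 2 powr - L * real (card A)" using assms by (simp add: mult.commute)
  finally have "(\<Sum>a\<in>A. 1 - ln 2 * (real (c a) - L)) \<le> real (card A)" by simp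
  then have "0 \<le> ln 2 * (\<Sum>a\<in>A. real (c a) - L)"
    by (simp add: sum_subtractf sum_distrib_left algebra_simps)
  then have "0 \<le> (\<Sum>a\<in>A. real (c a) - L)"
    by (simp add: zero_le_mult_iff)
  then show ?thesis by (simp add: sum_subtractf)
qed

text \<open>The term of index \<open>k\<close> in the series of \<open>exp (real k)\<close> is at
  most the whole sum, and \<open>exp 1 \<le> 3\<close>.\<close>

lemma fact_ge_power_third: "(real k / 3) ^ k \<le> fact k"
proof -
  have "real k ^ k / fact k \<le> exp (real k)"
  proof -
    have "(\<Sum>n\<in>{k}. real k ^ n / fact n) \<le> (\<Sum>n. real k ^ n / fact n)"
      using summable_exp[of "real k"] by (intro sum_le_suminf) (auto simp: field_simps)
    then show ?thesis by (simp add: exp_def field_simps)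
  qed
  also have "\<dots> = exp 1 ^ k" by (simp flip: exp_of_nat_mult)
  also have "\<dots> \<le> 3 ^ k" using exp_le by (intro power_mono) auto
  finally show ?thesis by (simp add: field_simps)
qed

lemma le_two_powr:
  fixes x :: real
  assumes "0 \<le> x"
  shows "x \<le> 2 powr x"
proof -
  have "x \<le> real (Suc (nat \<lfloor>x\<rfloor>))" using assms by linarith
  also have "\<dots> \<le> real (2 ^ nat \<lfloor>x\<rfloor>)"
    unfolding of_nat_le_iff by (rule Suc_leI) (rule less_exp)
  also have "\<dots> = 2 powr real (nat \<lfloor>x\<rfloor>)" by (simp add: powr_realpow)
  also have "\<dots> \<le> 2 powr x" using assms by (intro powr_mono) auto
  finally show ?thesis .
qed

text \<open>The two summands are those of the weight bound per set \<open>X\<close>. The first wants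
  \<open>m\<close> small and the second wants it large; \<open>fact k\<close> counts the orders of
  Bob's inputs.\<close>

lemma exists_threshold:
  fixes k :: nat
  assumes k: "12 ^ 4 \<le> log 2 (real k)"
  shows "\<exists>m\<le>k. real m ^ k + real k ^ (k + 1) / real k ^ m
           \<le> fact k * 2 powr - (real k * log 2 (log 2 (real k)) / 4)"
proof -
  \<comment> \<open>With this fourth root the target factor becomes \<open>1 / s ^ k\<close>; the
    bound \<open>12 ^ 4\<close> gives \<open>12 \<le> s\<close>.\<close>
  define s where "s = log 2 (real k) powr (1 / 4)"
  have l: "log 2 (real k) = s ^ 4"
    using k by (simp add: s_def powr_powr flip: powr_realpow)
  have s: "12 \<le> s"
    using k unfolding l by (subst (asm) power_mono_iff) (auto simp: s_def)
  have k0: "0 < k" using k by (cases "k = 0") (auto simp: log_def)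
  have k_eq: "real k = 2 powr (s ^ 4)" using k0 by (simp flip: l)
  have L: "2 powr - (real k * log 2 (log 2 (real k)) / 4) = 1 / s ^ k"
  proof -
    have "log 2 (log 2 (real k)) / 4 = log 2 s"
      unfolding l using s by (simp add: log_nat_power)
    then have eq: "real k * log 2 (log 2 (real k)) / 4 = log 2 s * real k" by simp
    have "2 powr - (real k * log 2 (log 2 (real k)) / 4) = (2 powr log 2 s) powr - real k"
      unfolding eq powr_powr by simp
    also have "\<dots> = 1 / s ^ k" using s by (simp add: powr_minus_divide powr_realpow)
    finally show ?thesis .
  qed
  define m where "m = nat \<lceil>real k / s\<^sup>2\<rceil>"
  have m_ge: "real k / s\<^sup>2 \<le> real m" unfolding m_def by linarith
  have s2: "0 < s\<^sup>2" using s by simp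
  have m_le: "real m \<le> 2 * real k / s\<^sup>2"
  proof -
    \<comment> \<open>The quotient \<open>k / s ^ 2\<close> is at least 1, so rounding it up at most
      doubles it.\<close>
    have "s\<^sup>2 \<le> s ^ 4" using s by (intro power_increasing) auto
    also have "\<dots> \<le> real k" unfolding k_eq by (rule le_two_powr) simp
    finally have "1 \<le> real k / s\<^sup>2" using s2 by simp
    then show ?thesis unfolding m_def by linarith
  qed
  have "m \<le> k"
  proof -
    have "real k / s\<^sup>2 \<le> real k" 
      using divide_left_mono[of 1 "s\<^sup>2" "real k"] s by simp
    then show ?thesis unfolding m_def by linarith
  qed
  \<comment> \<open>By \<open>12 \<le> s\<close>, \<open>2 / s ^ 2\<close> is at most
    \<open>1 / (6 * s)\<close>. The spare factor \<open>2 ^ k\<close> yields the final division by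
    2, which leaves room for the second summand.\<close>
  have "real m ^ k \<le> (2 * real k / s\<^sup>2) ^ k" using m_le by (intro power_mono) auto
  also have "\<dots> \<le> (real k / 3 / s / 2) ^ k"
    using s mult_right_mono[of 12 s "real k"]
    by (intro power_mono) (auto simp: field_simps power2_eq_square)
  also have "\<dots> \<le> (real k / 3 / s) ^ k / 2"
  proof -
    have "(2::real) ^ 1 \<le> 2 ^ k" using k0 by (intro power_increasing) auto
    then have "(real k / 3 / s) ^ k / 2 ^ k \<le> (real k / 3 / s) ^ k / 2"
      using s by (intro divide_left_mono) auto
    then show ?thesis by (simp only: power_divide)
  qed
  finally have first: "real m ^ k \<le> (real k / 3 / s) ^ k / 2" .
  \<comment> \<open>Here 12 splits as 4 times 3: \<open>4 ^ k\<close> absorbs \<open>2 * k\<close>,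
    and the 3 matches the lower bound for \<open>fact k\<close>. Then
    \<open>12 * s \<le> s ^ 2\<close>, and \<open>k ^ m\<close> is at least
    \<open>2 powr (s ^ 2 * k)\<close>.\<close>
  have "2 * real k * (3 * s) ^ k \<le> 4 ^ k * (3 * s) ^ k"
  proof (intro mult_right_mono)
    have "2 * real k \<le> 2 ^ k * 2 ^ k"
      using k0 self_le_power[of "2::real" k] of_nat_less_two_power[of k, where 'a = real]
      by (intro mult_mono) auto
    then show "2 * real k \<le> 4 ^ k" by (simp flip: power_mult_distrib)
  qed (use s in auto)
  also have "\<dots> = (12 * s) ^ k" unfolding power_mult_distrib[symmetric] by simp
  also have "\<dots> \<le> (s\<^sup>2) ^ k" using s by (intro power_mono) (auto simp: power2_eq_square)
  also have "\<dots> \<le> (2 powr s\<^sup>2) ^ k"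
    using s by (intro power_mono le_two_powr) auto
  also have "\<dots> = 2 powr (s ^ 4 * (real k / s\<^sup>2))"
  proof -
    have "s ^ 4 * (real k / s\<^sup>2) = s\<^sup>2 * real k"
      using s by (simp add: power4_eq_xxxx power2_eq_square)
    then show ?thesis by (simp add: powr_power mult.commute)
  qed
  also have "\<dots> \<le> 2 powr (s ^ 4 * real m)"
    using m_ge by (intro powr_mono mult_left_mono) auto
  also have "\<dots> = real k ^ m" by (simp add: k_eq powr_power mult.commute)
  finally have "2 * real k * (3 * s) ^ k \<le> real k ^ m" .
  then have "real k ^ (k + 1) / real k ^ m \<le> real k ^ (k + 1) / (2 * real k * (3 * s) ^ k)"
    using k0 s by (intro divide_left_mono) auto
  also have "\<dots> = real k ^ k / (3 * s) ^ k / 2" using k0 by simp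
  also have "\<dots> = (real k / 3 / s) ^ k / 2" by (simp add: power_divide power_mult_distrib)
  finally have second: "real k ^ (k + 1) / real k ^ m \<le> (real k / 3 / s) ^ k / 2" .
  have "real m ^ k + real k ^ (k + 1) / real k ^ m \<le> (real k / 3) ^ k * (1 / s ^ k)"
  proof -
    have "(real k / 3 / s) ^ k = (real k / 3) ^ k * (1 / s ^ k)" by (simp add: power_divide)
    then show ?thesis using first second by linarith
  qed
  also have "\<dots> \<le> fact k * (1 / s ^ k)"
    using fact_ge_power_third s by (intro mult_right_mono) auto
  finally show ?thesis using \<open>m \<le> k\<close> unfolding L by blast
qed

section \<open>Averaging over hard inputs and public randomness\<close>

lemma sum_total_cost_ge:
  fixes P :: "(nat set, nat, bool) online_protocol"
  assumes k: "12 ^ 4 \<le> log 2 (real k)" and n: "k ^ 2 \<le> n"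
    and correct: "\<And>X ys. (X, ys) \<in> set_intersection_inputs n k \<Longrightarrow> correct_on set_intersection P X ys"
  shows "real (card (SIGMA X:{X. X \<subseteq> {1..n} \<and> card X = k}. permutations_of_set X))
           * (real k * log 2 (log 2 (real k)) / 4)
         \<le> (\<Sum>(X, ys)\<in>(SIGMA X:{X. X \<subseteq> {1..n} \<and> card X = k}. permutations_of_set X).
               real (total_cost P X ys))"
proof -
  define F where "F = {X. X \<subseteq> {1..n} \<and> card X = k}"
  have finF: "finite F" by (simp add: F_def)
  have cardF: "card F = n choose k" by (simp add: F_def n_subsets)
  have XF: "finite X" "card X = k" "X \<subseteq> {1..n}" if "X \<in> F" for X
    using that finite_subset by (auto simp: F_def)
  have card: "card (Sigma F permutations_of_set) = card F * fact k"
    using finF XF by simp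
  have "2 \<le> k"
  proof (rule ccontr)
    assume "\<not> 2 \<le> k"
    then have "k = 0 \<or> k = 1" by auto
    then show False using k by (auto simp: log_def)
  qed
  obtain m where m: "m \<le> k" "real m ^ k + real k ^ (k + 1) / real k ^ m
           \<le> fact k * 2 powr - (real k * log 2 (log 2 (real k)) / 4)"
    using exists_threshold[OF k] by blast
  have "(\<Sum>X\<in>F. \<Sum>ys\<in>permutations_of_set (X - {}). 1 / 2 ^ remaining_cost P X [] ys)
      \<le> real m ^ k * real (card F) + real (card {1..n} choose k) * real k ^ (2 * k + 1) / real k ^ (k + m)"
  proof (rule online_protocol_weight_le)
    show "result (P (run_from P X [] (take i ys))) X (ys ! i) \<longleftrightarrow> ys ! i \<in> X"
      if "X \<in> F" "set ys \<subseteq> {1..n}" "length ys = k" "i < k" for X ys i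
      using correct[of X ys] that
      by (auto simp: F_def set_intersection_inputs_def correct_on_def stage_output_def run_def
          set_intersection_def)
  qed (use n \<open>2 \<le> k\<close> m(1) in \<open>auto simp: F_def\<close>)
  \<comment> \<open>As \<open>F\<close> consists of all \<open>k\<close>-subsets, the error term too
    is a multiple of \<open>card F\<close>.\<close>
  also have "\<dots> = real (card F) * (real m ^ k + real k ^ (k + 1) / real k ^ m)"
    using \<open>2 \<le> k\<close> by (simp add: cardF power_add mult_2 mult_2_right field_simps)
  also have "\<dots> \<le> real (card F) * (fact k * 2 powr - (real k * log 2 (log 2 (real k)) / 4))"
    using m(2) by (intro mult_left_mono) auto
  finally have "(\<Sum>(X, ys)\<in>Sigma F permutations_of_set. 1 / 2 ^ total_cost P X ys)
      \<le> real (card (Sigma F permutations_of_set)) * 2 powr - (real k * log 2 (log 2 (real k)) / 4)"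
    using finF XF by (subst sum.Sigma[symmetric]) (auto simp: card total_cost_eq_remaining_cost)
  then show ?thesis
    unfolding case_prod_unfold F_def[symmetric] by (rule sum_ge_of_sum_half_power_le)
qed

text \<open>The averaging direction of Yao's principle: the worst input in \<open>D\<close> costs at
  least the mean over \<open>A\<close>, and expectation commutes with the finite sum. In
  \<open>avg\<close> correctness covers all of \<open>D\<close>, since the argument for
  deterministic protocols also relies on correct "no" answers, which inputs from \<open>A\<close>
  alone would not test.\<close>

lemma expected_cost_ge_average:
  assumes zero_error: "zero_error_protocol f D M" and D: "finite D" and A: "A \<subseteq> D" "A \<noteq> {}"
    and avg: "\<And>P. (\<And>x ys. (x, ys) \<in> D \<Longrightarrow> correct_on f P x ys) \<Longrightarrow>
      real (card A) * L \<le> (\<Sum>(x, ys)\<in>A. real (total_cost P x ys))"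
  shows "ennreal L \<le> expected_cost D M"
proof -
  interpret prob_space M using zero_error by (simp add: zero_error_protocol_def)
  have finA: "finite A" using A D finite_subset by blast
  have cardA: "0 < card A" using A finA by (simp add: card_gt_0_iff)
  have meas: "(\<lambda>P. of_nat (total_cost P x ys) :: ennreal) \<in> borel_measurable M" if "(x, ys) \<in> A" for x ys
  proof -
    have "(\<lambda>P. total_cost P x ys) \<in> measurable M (count_space UNIV)"
      using zero_error that A by (auto simp: zero_error_protocol_def)
    then show ?thesis by measurable
  qed
  \<comment> \<open>Finiteness of \<open>D\<close> merges the almost sure events of the single
    inputs into one.\<close>
  have "AE P in M. \<forall>z\<in>D. correct_on f P (fst z) (snd z)"
    using zero_error D by (intro AE_finite_allI) (auto simp: zero_error_protocol_def)
  then have "AE P in M. ennreal (real (card A) * L) \<le> (\<Sum>(x, ys)\<in>A. of_nat (total_cost P x ys))"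
  proof eventually_elim
    case (elim P)
    then have "real (card A) * L \<le> (\<Sum>(x, ys)\<in>A. real (total_cost P x ys))"
      by (intro avg) auto
    then have "ennreal (real (card A) * L) \<le> ennreal (\<Sum>(x, ys)\<in>A. real (total_cost P x ys))"
      by (rule ennreal_leI)
    also have "\<dots> = (\<Sum>(x, ys)\<in>A. of_nat (total_cost P x ys))"
      by (subst sum_ennreal[symmetric]) (auto simp: ennreal_of_nat_eq_real_of_nat case_prod_unfold)
    finally show ?case .
  qed
  then have "(\<integral>\<^sup>+ P. ennreal (real (card A) * L) \<partial>M)
      \<le> (\<integral>\<^sup>+ P. (\<Sum>(x, ys)\<in>A. of_nat (total_cost P x ys)) \<partial>M)"
    by (rule nn_integral_mono_AE)
  also have "\<dots> = (\<Sum>(x, ys)\<in>A. \<integral>\<^sup>+ P. of_nat (total_cost P x ys) \<partial>M)"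
    using meas by (simp add: case_prod_unfold nn_integral_sum)
  also have "\<dots> \<le> (\<Sum>z\<in>A. expected_cost D M)"
    unfolding expected_cost_def case_prod_unfold
    using A by (intro sum_mono SUP_upper) auto
  finally have "of_nat (card A) * ennreal L \<le> of_nat (card A) * expected_cost D M"
    by (simp add: emeasure_space_1 ennreal_mult' ennreal_of_nat_eq_real_of_nat)
  then show ?thesis
    using cardA by (subst (asm) ennreal_mult_le_mult_iff) auto
qed

theorem theorem10:
  shows "\<exists>c::real. c > 0 \<and> (\<exists>k0::nat. \<forall>k\<ge>k0. \<forall>n::nat. n \<ge> k ^ 2 \<longrightarrow>
    (\<forall>M :: (nat set, nat, bool) online_protocol measure.
       zero_error_protocol set_intersection (set_intersection_inputs n k) M \<longrightarrow>
       expected_cost (set_intersection_inputs n k) M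
         \<ge> ennreal (c * real k * log 2 (log 2 (real k)))))"
proof -
  \<comment> \<open>Chosen so that \<open>log 2 k\<close> reaches the \<open>12 ^ 4\<close> demanded
    by the threshold.\<close>
  obtain k0 :: nat where k0: "2 powr (12 ^ 4) \<le> real k0"
    using real_arch_simple by blast
  have "ennreal (1 / 4 * real k * log 2 (log 2 (real k))) \<le> expected_cost (set_intersection_inputs n k) M"
    if "k0 \<le> k" and n: "k ^ 2 \<le> n"
      and M: "zero_error_protocol set_intersection (set_intersection_inputs n k) M"
    for k n and M :: "(nat set, nat, bool) online_protocol measure"
  proof (rule expected_cost_ge_average[OF M])
    let ?A = "SIGMA X:{X. X \<subseteq> {1..n} \<and> card X = k}. permutations_of_set X"
    have "(2::real) powr (12 ^ 4) \<le> real k" using k0 \<open>k0 \<le> k\<close> by linarith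
    moreover have "0 < (2::real) powr (12 ^ 4)" by (rule powr_gt_zero[THEN iffD2]) simp
    ultimately have k: "12 ^ 4 \<le> log 2 (real k)"
      by (subst le_log_iff) linarith+
    have "set_intersection_inputs n k \<subseteq> Pow {1..n} \<times> {ys. set ys \<subseteq> {1..n} \<and> length ys = k}"
      by (auto simp: set_intersection_inputs_def)
    then show "finite (set_intersection_inputs n k)"
      by (rule finite_subset) (simp add: finite_lists_length_eq)
    show "?A \<subseteq> set_intersection_inputs n k"
      by (auto simp: set_intersection_inputs_def permutations_of_set_def distinct_card)
    have "k \<le> n" using n by (cases k) (auto simp: power2_eq_square)
    then have "{1..k} \<in> {X. X \<subseteq> {1..n} \<and> card X = k}" "[1..<Suc k] \<in> permutations_of_set {1..k}"
      by (auto simp: permutations_of_set_def)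
    then show "?A \<noteq> {}" by blast
    show "real (card ?A) * (1 / 4 * real k * log 2 (log 2 (real k)))
        \<le> (\<Sum>(X, ys)\<in>?A. real (total_cost P X ys))"
      if "\<And>X ys. (X, ys) \<in> set_intersection_inputs n k \<Longrightarrow> correct_on set_intersection P X ys" for P
      using sum_total_cost_ge[OF k n that] by simp
  qed
  then show ?thesis by (intro exI[of _ "1 / 4"] conjI exI[of _ k0]) auto
qed

end
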